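(* For every integer $n\ge 2$ and all real numbers $\mu_0>0$, $\mu_1>0$ and $l\ge 1$, one has $$C^{(6)}_1>C^{(6)}_2,\qquad\text{and consequently}\qquad E^{(6)}_1=6^{1/C^{(6)}_1}<E^{(6)}_2=6^{1/C^{(6)}_2},$$ where $$C^{(6)}_1=2n\mu_0+2n^2\mu_1+\frac n2\left(2n^2+15n-3+3l(n+1)\right),$$ $$C^{(6)}_2=2n\mu_0+2n^2\mu_1+\frac n3\left(2n^2+18n+4+3l(n+1)\right).$$
   Context: The methods solve a system $F(x)=0$ of $n$ nonlinear equations in $n$ unknowns, with $F:D\subseteq\mathbb{R}^n\to\mathbb{R}^n$. Method $\phi^{(6)}_1$ (assigned order of convergence $6$): $y^{(k)}=x^{(k)}-F'(x^{(k)})^{-1}F(x^{(k)})$, $z^{(k)}=x^{(k)}-2[F'(x^{(k)})+F'(y^{(k)})]^{-1}F(x^{(k)})$, $x^{(k+1)}=z^{(k)}-[3F'(y^{(k)})-F'(x^{(k)})]^{-1}[F'(x^{(k)})+F'(y^{(k)})]F'(x^{(k)})^{-1}F(z^{(k)})$. Method $\phi^{(6)}_2$ (assigned order of convergence $6$): $y^{(k)}=x^{(k)}-\frac23F'(x^{(k)})^{-1}F(x^{(k)})$, $z^{(k)}=x^{(k)}-\frac12[3F'(y^{(k)})-F'(x^{(k)})]^{-1}[3F'(y^{(k)})+F'(x^{(k)})]F'(x^{(k)})^{-1}F(x^{(k)})$, $x^{(k+1)}=z^{(k)}-2[3F'(y^{(k)})-F'(x^{(k)})]^{-1}F(z^{(k)})$.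 The efficiency index of a method with order $p$ and computational cost $C>0$ per iteration is $E=p^{1/C}$. The cost is measured in numbers of products; $\mu_0$ and $\mu_1$ are the ratios expressing, in products, the cost of one scalar evaluation of a component of $F$ and of an entry of $F'$ respectively, and one quotient is counted as $l$ products. $C^{(6)}_1$ and $C^{(6)}_2$ are the costs, and $E^{(6)}_1$ and $E^{(6)}_2$ the efficiency indices, of $\phi^{(6)}_1$ and $\phi^{(6)}_2$; the explicit formulas for the costs in the claim are taken as their definitions. *)

theory Defs
  imports Complex_Main
begin

text \<open>
  The computational cost per iteration, in numbers of products, of the sixth-order methods
  \<open>\<phi>\<^sub>1\<close> and \<open>\<phi>\<^sub>2\<close> on a system of \<open>n\<close> equations in \<open>n\<close> unknowns. The parameters \<open>\<mu>0\<close> and \<open>\<mu>1\<close>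
  are the costs of one scalar evaluation of a component of \<open>F\<close> and of an entry of \<open>F'\<close>,
  and \<open>l\<close> that of a quotient; all three are real numbers, measured in products.
\<close>

definition cost61 :: "nat \<Rightarrow> real \<Rightarrow> real \<Rightarrow> real \<Rightarrow> real" where
  "cost61 n \<mu>0 \<mu>1 l =
     2 * real n * \<mu>0 + 2 * (real n)\<^sup>2 * \<mu>1
     + real n / 2 * (2 * (real n)\<^sup>2 + 15 * real n - 3 + 3 * l * (real n + 1))"

definition cost62 :: "nat \<Rightarrow> real \<Rightarrow> real \<Rightarrow> real \<Rightarrow> real" where
  "cost62 n \<mu>0 \<mu>1 l =
     2 * real n * \<mu>0 + 2 * (real n)\<^sup>2 * \<mu>1
     + real n / 3 * (2 * (real n)\<^sup>2 + 18 * real n + 4 + 3 * l * (real n + 1))"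

text \<open>
  The efficiency index of a method of order \<open>p\<close> and cost \<open>C\<close>; it is meaningful only for
  \<open>C > 0\<close> (for \<open>C = 0\<close> the convention \<open>1 / 0 = 0\<close> would give \<open>1\<close>).
\<close>

definition efficiency_index :: "nat \<Rightarrow> real \<Rightarrow> real" where
  "efficiency_index p C = real p powr (1 / C)"

definition eff61 :: "nat \<Rightarrow> real \<Rightarrow> real \<Rightarrow> real \<Rightarrow> real" where
  "eff61 n \<mu>0 \<mu>1 l = efficiency_index 6 (cost61 n \<mu>0 \<mu>1 l)"

definition eff62 :: "nat \<Rightarrow> real \<Rightarrow> real \<Rightarrow> real \<Rightarrow> real" where
  "eff62 n \<mu>0 \<mu>1 l = efficiency_index 6 (cost62 n \<mu>0 \<mu>1 l)"

lemma cost61_pos: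
  assumes "n \<ge> 2" "\<mu>0 > 0" "\<mu>1 > 0" "l \<ge> 1"
  shows "cost61 n \<mu>0 \<mu>1 l > 0"
proof -
  have n: "real n \<ge> 2" using assms(1) by simp
  have "2 * (real n)\<^sup>2 \<ge> 0" "3 * l * (real n + 1) \<ge> 0" using assms(4) by simp_all
  then have "2 * (real n)\<^sup>2 + 15 * real n - 3 + 3 * l * (real n + 1) > 0"
    using n by linarith
  then have "real n / 2 * (2 * (real n)\<^sup>2 + 15 * real n - 3 + 3 * l * (real n + 1)) > 0"
    using n by (intro mult_pos_pos) simp_all
  moreover have "2 * real n * \<mu>0 > 0" "2 * (real n)\<^sup>2 * \<mu>1 > 0"
    using n assms(2,3) by simp_all
  ultimately show ?thesis
    unfolding cost61_def by linarith
qed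

lemma cost62_pos:
  assumes "n \<ge> 2" "\<mu>0 > 0" "\<mu>1 > 0" "l \<ge> 1"
  shows "cost62 n \<mu>0 \<mu>1 l > 0"
proof -
  have n: "real n \<ge> 2" using assms(1) by simp
  have "2 * (real n)\<^sup>2 \<ge> 0" "3 * l * (real n + 1) \<ge> 0" using assms(4) by simp_all
  then have "2 * (real n)\<^sup>2 + 18 * real n + 4 + 3 * l * (real n + 1) > 0"
    using n by linarith
  then have "real n / 3 * (2 * (real n)\<^sup>2 + 18 * real n + 4 + 3 * l * (real n + 1)) > 0"
    using n by (intro mult_pos_pos) simp_all
  moreover have "2 * real n * \<mu>0 > 0" "2 * (real n)\<^sup>2 * \<mu>1 > 0"
    using n assms(2,3) by simp_all
  ultimately show ?thesis
    unfolding cost62_def by linarith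
qed

end

theory Submission
  imports Defs
begin

text \<open>Both methods use the same function and Jacobian evaluations, so the terms in
  \<open>\<mu>0\<close> and \<open>\<mu>1\<close> cancel in the difference of the costs
  (\<open>cost61_minus_cost62\<close>). What is left is \<open>n / 6\<close> times a bracket that is
  positive for \<open>n \<ge> 2\<close> (\<open>cost62_less_cost61\<close>). Both methods have order
  6, so the cheaper one has the larger index
  (\<open>efficiency_index_strict_antimono\<close>).\<close>

lemma cost61_minus_cost62:
  "cost61 n \<mu>0 \<mu>1 l - cost62 n \<mu>0 \<mu>1 l =
     real n / 6 * (2 * (real n)\<^sup>2 + 9 * real n - 17 + 3 * l * (real n + 1))"
  unfolding cost61_def cost62_def by (simp add: field_simps)

lemma cost62_less_cost61:
  assumes "n \<ge> 2" and "l \<ge> 1"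
  shows "cost62 n \<mu>0 \<mu>1 l < cost61 n \<mu>0 \<mu>1 l"
proof -
  have n: "real n \<ge> 2" using assms(1) by simp
  \<comment> \<open>Bounding the square below by 4 makes the estimate linear: the
    \<open>l\<close>-free part of the bracket is at least 8 + 18 - 17 = 9.\<close>
  have "(real n)\<^sup>2 \<ge> 2\<^sup>2" using n by (intro power_mono) simp_all
  moreover have "3 * l * (real n + 1) \<ge> 0" using assms(2) by simp
  ultimately have "2 * (real n)\<^sup>2 + 9 * real n - 17 + 3 * l * (real n + 1) > 0"
    using n by simp
  then have "real n / 6 * (2 * (real n)\<^sup>2 + 9 * real n - 17 + 3 * l * (real n + 1)) > 0"
    using n by (intro mult_pos_pos) simp_all
  then show ?thesis
    using cost61_minus_cost62[of n \<mu>0 \<mu>1 l] by linarith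
qed

text \<open>On positive costs the exponent \<open>1 / C\<close> strictly decreases in
  \<open>C\<close>, and a power with base above 1 strictly increases in its exponent.\<close>

lemma efficiency_index_strict_antimono:
  assumes "p > 1" and "0 < C" and "C < C'"
  shows "efficiency_index p C' < efficiency_index p C"
  unfolding efficiency_index_def
  using assms by (intro powr_less_mono) (simp_all add: frac_less2)

theorem mainTheorem2:
  fixes n :: nat and \<mu>0 \<mu>1 l :: real
  assumes "n \<ge> 2" and "\<mu>0 > 0" and "\<mu>1 > 0" and "l \<ge> 1"
  shows "cost61 n \<mu>0 \<mu>1 l > cost62 n \<mu>0 \<mu>1 l \<and>
         eff61 n \<mu>0 \<mu>1 l = 6 powr (1 / cost61 n \<mu>0 \<mu>1 l) \<and>
         eff62 n \<mu>0 \<mu>1 l = 6 powr (1 / cost62 n \<mu>0 \<mu>1 l) \<and>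
         eff61 n \<mu>0 \<mu>1 l < eff62 n \<mu>0 \<mu>1 l"
proof (intro conjI)
  show less: "cost61 n \<mu>0 \<mu>1 l > cost62 n \<mu>0 \<mu>1 l"
    using assms(1,4) by (rule cost62_less_cost61)
  show "eff61 n \<mu>0 \<mu>1 l = 6 powr (1 / cost61 n \<mu>0 \<mu>1 l)"
    by (simp add: eff61_def efficiency_index_def)
  show "eff62 n \<mu>0 \<mu>1 l = 6 powr (1 / cost62 n \<mu>0 \<mu>1 l)"
    by (simp add: eff62_def efficiency_index_def)
  show "eff61 n \<mu>0 \<mu>1 l < eff62 n \<mu>0 \<mu>1 l"
    unfolding eff61_def eff62_def
    \<comment> \<open>Only the smaller cost has to be shown positive, to keep both reciprocals on
      the positive branch.\<close>
    using cost62_pos[OF assms] less by (intro efficiency_index_strict_antimono) simp_all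
qed

end
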